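(* Let $n\ge 1$ and let $D\subseteq S_n$ be a nonempty $1$-design in $(S_n,d_S)$. Then the covering radius of $D$ satisfies $\rho(D)\le n-1$.
   Context: $S_n$ is the symmetric group on $n$ letters with the metric $d_S(\sigma,\theta)=n-F(\sigma\theta^{-1})$, where $F(\nu)$ is the number of fixed points of $\nu$. For $0\le i\le n$ let $E_i=\{(x,y)\in S_n^2: d_S(x,y)=i\}$, and let $w_k$ be the number of permutations of $n$ letters with exactly $k$ fixed points; put $v_j=w_{n-j}$. For a nonempty $D\subseteq S_n$, its frequencies are $f_i=|D^2\cap E_i|/|D|^2$ (with $D^2$ the set of ordered pairs). $D$ is a $t$-design if $\sum_{j=0}^n f_j j^i=\sum_{j=0}^n \frac{v_j}{n!}j^i$ for all $i=1,\dots,t$. The covering radius is $\rho(D)=\max_{x\in S_n}\min_{y\in D} d_S(x,y)$. *)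

theory Defs
  imports Complex_Main "HOL-Combinatorics.Permutations"
begin

text \<open>
  The \<open>n\<close> letters are \<open>{1..n}\<close>. A permutation of them is a function on \<open>nat\<close> that fixes every
  number outside \<open>{1..n}\<close>, so fixed points have to be counted inside \<open>{1..n}\<close> only.
\<close>

definition sym_grp :: "nat \<Rightarrow> (nat \<Rightarrow> nat) set" where
  "sym_grp n = {p. p permutes {1..n}}"

definition fixpts :: "nat \<Rightarrow> (nat \<Rightarrow> nat) \<Rightarrow> nat" where
  "fixpts n p = card {i \<in> {1..n}. p i = i}"

text \<open>The subtraction on \<open>nat\<close> never truncates, since \<open>fixpts n p \<le> n\<close>.\<close>

definition dS :: "nat \<Rightarrow> (nat \<Rightarrow> nat) \<Rightarrow> (nat \<Rightarrow> nat) \<Rightarrow> nat" where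
  "dS n p q = n - fixpts n (p \<circ> inv q)"

definition dist_rel :: "nat \<Rightarrow> nat \<Rightarrow> ((nat \<Rightarrow> nat) \<times> (nat \<Rightarrow> nat)) set" where
  "dist_rel n i = {(x, y) \<in> sym_grp n \<times> sym_grp n. dS n x y = i}"

definition num_fix :: "nat \<Rightarrow> nat \<Rightarrow> nat" where
  "num_fix n k = card {p \<in> sym_grp n. fixpts n p = k}"

text \<open>Only used for \<open>j \<le> n\<close>.\<close>

definition valency :: "nat \<Rightarrow> nat \<Rightarrow> nat" where
  "valency n j = num_fix n (n - j)"

definition frequency :: "nat \<Rightarrow> (nat \<Rightarrow> nat) set \<Rightarrow> nat \<Rightarrow> real" where
  "frequency n D i = real (card ((D \<times> D) \<inter> dist_rel n i)) / (real (card D))\<^sup>2"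

definition is_design :: "nat \<Rightarrow> nat \<Rightarrow> (nat \<Rightarrow> nat) set \<Rightarrow> bool" where
  "is_design n t D \<longleftrightarrow>
     D \<noteq> {} \<and> D \<subseteq> sym_grp n \<and>
     (\<forall>i\<in>{1..t}.
        (\<Sum>j=0..n. frequency n D j * real j ^ i) =
        (\<Sum>j=0..n. real (valency n j) / fact n * real j ^ i))"

text \<open>The maximum and minima range over finite nonempty sets when \<open>D\<close> is nonempty and \<open>D \<subseteq> sym_grp n\<close>.\<close>

definition covering_radius :: "nat \<Rightarrow> (nat \<Rightarrow> nat) set \<Rightarrow> nat" where
  "covering_radius n D = Max ((\<lambda>x. Min ((\<lambda>y. dS n x y) ` D)) ` sym_grp n)"

end

theory Submission
  imports Defs
begin

text \<open>
  Let \<open>M i j\<close> be the number of elements of \<open>D\<close> sending \<open>i\<close> to \<open>j\<close>. The entries of \<open>M\<close> sum to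
  \<open>n |D|\<close>, and their squares sum to the number of coincidences \<open>y i = z i\<close> with \<open>y, z \<in> D\<close>.
  A random permutation has one fixed point on average, so the design condition of order \<open>1\<close> says
  that the squares sum to \<open>|D|\<^sup>2\<close>. This is the equality case of Cauchy--Schwarz, hence every
  entry of \<open>M\<close> equals \<open>|D| / n > 0\<close>: for every \<open>x\<close> some \<open>y \<in> D\<close> agrees with \<open>x\<close> at the letter \<open>1\<close>.
\<close>

lemma finite_sym_grp: "finite (sym_grp n)"
  by (simp add: sym_grp_def finite_permutations)

lemma card_sym_grp: "card (sym_grp n) = fact n"
  using card_permutations[of "{1..n}" n] by (simp add: sym_grp_def)

lemma fixpts_le: "fixpts n p \<le> n"
  unfolding fixpts_def using card_mono[of "{1..n}" "{i \<in> {1..n}. p i = i}"] by fastforce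

text \<open>\<open>y\<close> maps the letters where \<open>x\<close> and \<open>y\<close> agree
  bijectively onto the fixed points of \<open>x \<circ> inv y\<close>. Hence \<open>dS\<close> is
  the Hamming distance.\<close>

lemma fixpts_comp_inv:
  assumes "y \<in> sym_grp n"
  shows "fixpts n (x \<circ> inv y) = card {i \<in> {1..n}. x i = y i}"
proof -
  have y: "y permutes {1..n}"
    using assms by (simp add: sym_grp_def)
  have "{i \<in> {1..n}. (x \<circ> inv y) i = i} = y ` {i \<in> {1..n}. x i = y i}"
  proof (intro equalityI subsetI)
    fix k assume k: "k \<in> {i \<in> {1..n}. (x \<circ> inv y) i = i}"
    then have "inv y k \<in> {i \<in> {1..n}. x i = y i}"
      using permutes_in_image[OF permutes_inv[OF y], of k] permutes_inverses(1)[OF y, of k] by simp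
    then show "k \<in> y ` {i \<in> {1..n}. x i = y i}"
      using permutes_inverses(1)[OF y, of k] by (metis imageI)
  next
    fix k assume "k \<in> y ` {i \<in> {1..n}. x i = y i}"
    then show "k \<in> {i \<in> {1..n}. (x \<circ> inv y) i = i}"
      using permutes_in_image[OF y] permutes_inverses(2)[OF y] by auto
  qed
  moreover have "inj_on y {i \<in> {1..n}. x i = y i}"
    using permutes_inj[OF y] by (rule inj_on_subset) simp
  ultimately show ?thesis
    unfolding fixpts_def by (simp add: card_image)
qed

text \<open>Double counting of the pairs of a permutation and a letter that it fixes: the stabiliser
  of each of the \<open>n\<close> letters is the symmetric group on the other
  \<open>n - 1\<close>.\<close>

lemma sum_fixpts:
  assumes "n \<ge> 1"
  shows "(\<Sum>p\<in>sym_grp n. fixpts n p) = fact n"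
proof -
  have stab: "card {p \<in> sym_grp n. p i = i} = fact (n - 1)" if "i \<in> {1..n}" for i
  proof -
    have "{p \<in> sym_grp n. p i = i} = {p. p permutes ({1..n} - {i})}"
    proof (intro equalityI subsetI)
      fix p assume "p \<in> {p \<in> sym_grp n. p i = i}"
      then show "p \<in> {p. p permutes ({1..n} - {i})}"
        by (auto simp: sym_grp_def intro: permutes_superset)
    next
      fix p assume "p \<in> {p. p permutes ({1..n} - {i})}"
      then show "p \<in> {p \<in> sym_grp n. p i = i}"
        by (auto simp: sym_grp_def intro: permutes_subset dest: permutes_not_in[of _ _ i])
    qed
    then show ?thesis
      using card_permutations[of "{1..n} - {i}" "n - 1"] that by simp
  qed
  have "(\<Sum>p\<in>sym_grp n. fixpts n p) = (\<Sum>p\<in>sym_grp n. \<Sum>i\<in>{1..n}. of_bool (p i = i))"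
    by (simp add: fixpts_def Int_def)
  also have "\<dots> = (\<Sum>i\<in>{1..n}. \<Sum>p\<in>sym_grp n. of_bool (p i = i))"
    by (rule sum.swap)
  also have "\<dots> = (\<Sum>i\<in>{1..n}. card {p \<in> sym_grp n. p i = i})"
    by (simp add: finite_sym_grp Int_def)
  also have "\<dots> = n * fact (n - 1)"
    by (simp add: stab)
  also have "\<dots> = fact n"
    using assms by (simp add: fact_reduce)
  finally show ?thesis .
qed

text \<open>This is the mean distance to the identity over all permutations, that is,
  \<open>n\<close> minus the mean number of fixed points.\<close>

lemma sum_valency:
  assumes "n \<ge> 1"
  shows "(\<Sum>j=0..n. real (valency n j) / fact n * real j) = real n - 1"
proof -
  have val: "valency n j = card {p \<in> sym_grp n. n - fixpts n p = j}" if "j \<in> {0..n}" for j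
  proof -
    \<comment> \<open>Neither subtraction truncates, as \<open>j\<close> and
      \<open>fixpts n p\<close> are at most \<open>n\<close>.\<close>
    have "fixpts n p = n - j \<longleftrightarrow> n - fixpts n p = j" for p
      using that fixpts_le[of n p] by auto
    then show ?thesis
      by (simp add: valency_def num_fix_def)
  qed
  have "(\<Sum>j=0..n. real (valency n j) / fact n * real j)
      = (\<Sum>j=0..n. real (card {p \<in> sym_grp n. n - fixpts n p = j}) * real j) / fact n"
    by (simp add: val sum_divide_distrib)
  also have "\<dots> = (\<Sum>p\<in>sym_grp n. real (n - fixpts n p)) / fact n"
    by (subst sum_fun_comp[where R = "{0..n}"]) (auto simp: finite_sym_grp)
  also have "(\<Sum>p\<in>sym_grp n. real (n - fixpts n p)) = fact n * (real n - 1)"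
  proof -
    have "(\<Sum>p\<in>sym_grp n. real (fixpts n p)) = fact n"
      using arg_cong[OF sum_fixpts[OF assms], of real] by simp
    then show ?thesis
      by (simp add: fixpts_le of_nat_diff sum_subtractf card_sym_grp algebra_simps)
  qed
  finally show ?thesis
    by simp
qed

text \<open>Grouping the ordered pairs of \<open>D\<close> by distance turns the left side into the
  mean of \<open>dS\<close> over these pairs, and \<open>dS\<close> is \<open>n\<close> minus the
  number of agreements.\<close>

lemma sum_frequency:
  assumes "D \<subseteq> sym_grp n" "D \<noteq> {}"
  shows "(\<Sum>j=0..n. frequency n D j * real j)
       = real n - (\<Sum>y\<in>D. \<Sum>z\<in>D. real (card {i \<in> {1..n}. y i = z i})) / (real (card D))\<^sup>2"
proof -
  have fin: "finite D"
    using assms finite_sym_grp finite_subset by blast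
  then have pos: "card D > 0"
    using assms by (simp add: card_gt_0_iff)
  have rel: "(D \<times> D) \<inter> dist_rel n j = {yz \<in> D \<times> D. (\<lambda>(y, z). dS n y z) yz = j}" for j
    using assms by (auto simp: dist_rel_def)
  have "(\<Sum>j=0..n. frequency n D j * real j)
      = (\<Sum>j=0..n. real (card {yz \<in> D \<times> D. (\<lambda>(y, z). dS n y z) yz = j}) * real j)
        / (real (card D))\<^sup>2"
    by (simp add: frequency_def rel sum_divide_distrib)
  also have "\<dots> = (\<Sum>yz\<in>D \<times> D. real ((\<lambda>(y, z). dS n y z) yz)) / (real (card D))\<^sup>2"
    by (subst sum_fun_comp[where R = "{0..n}"]) (auto simp: fin dS_def)
  also have "(\<Sum>yz\<in>D \<times> D. real ((\<lambda>(y, z). dS n y z) yz)) = (\<Sum>y\<in>D. \<Sum>z\<in>D. real (dS n y z))"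
    by (simp add: sum.cartesian_product case_prod_unfold)
  also have "\<dots> = (\<Sum>y\<in>D. \<Sum>z\<in>D. real n - real (card {i \<in> {1..n}. y i = z i}))"
  proof (intro sum.cong refl)
    fix y z assume "z \<in> D"
    then have "z \<in> sym_grp n" using assms by blast
    then show "real (dS n y z) = real n - real (card {i \<in> {1..n}. y i = z i})"
      unfolding dS_def by (metis fixpts_comp_inv fixpts_le of_nat_diff)
  qed
  also have "\<dots> = real n * (real (card D))\<^sup>2
      - (\<Sum>y\<in>D. \<Sum>z\<in>D. real (card {i \<in> {1..n}. y i = z i}))"
    by (simp add: sum_subtractf power2_eq_square algebra_simps)
  finally show ?thesis
    using pos by (simp add: diff_divide_distrib)
qed

text \<open>The design condition equates the mean distance within \<open>D\<close> with
  \<open>n - 1\<close>, so two members of \<open>D\<close> agree at one letter on average.\<close>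

lemma design_coincidences:
  assumes "n \<ge> 1" "is_design n 1 D"
  shows "(\<Sum>y\<in>D. \<Sum>z\<in>D. real (card {i \<in> {1..n}. y i = z i})) = (real (card D))\<^sup>2"
proof -
  have D: "D \<subseteq> sym_grp n" "D \<noteq> {}"
    and eq: "(\<Sum>j=0..n. frequency n D j * real j)
      = (\<Sum>j=0..n. real (valency n j) / fact n * real j)"
    using assms(2) by (auto simp: is_design_def)
  have "card D > 0"
    using D finite_sym_grp finite_subset card_gt_0_iff by blast
  then show ?thesis
    using eq unfolding sum_frequency[OF D] sum_valency[OF assms(1)] by simp
qed

lemma design_transitive:
  assumes "n \<ge> 1" "is_design n 1 D" "i \<in> {1..n}" "j \<in> {1..n}"
  shows "\<exists>y\<in>D. y i = j"
proof -
  have D: "D \<subseteq> sym_grp n" "D \<noteq> {}"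
    using assms(2) by (auto simp: is_design_def)
  have fin: "finite D"
    using D finite_sym_grp finite_subset by blast
  then have pos: "card D > 0"
    using D by (simp add: card_gt_0_iff)
  define d where "d = real (card D)"
  define M where "M i j = real (card {y \<in> D. y i = j})" for i j
  have img: "(\<lambda>y. y i) ` D \<subseteq> {1..n}" if "i \<in> {1..n}" for i
    using D that permutes_in_image by (fastforce simp: sym_grp_def)
  \<comment> \<open>Elements of \<open>D\<close> are grouped by their image of \<open>i\<close>. The
    constant \<open>g = 1\<close> gives the row sums of \<open>M\<close>, and \<open>g = M i\<close>
    the sums of squares.\<close>
  have fibre: "(\<Sum>j\<in>{1..n}. M i j * g j) = (\<Sum>y\<in>D. g (y i))" if "i \<in> {1..n}" for i g
    using sum_fun_comp[OF fin _ img[OF that], of g] by (simp add: M_def)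
  have row: "(\<Sum>j\<in>{1..n}. M i j) = d" if "i \<in> {1..n}" for i
    using fibre[OF that, of "\<lambda>_. 1"] by (simp add: d_def)
  have "(\<Sum>i\<in>{1..n}. \<Sum>j\<in>{1..n}. (M i j)\<^sup>2) = (\<Sum>i\<in>{1..n}. \<Sum>y\<in>D. M i (y i))"
    using fibre by (intro sum.cong) (simp_all add: power2_eq_square)
  also have "\<dots> = (\<Sum>i\<in>{1..n}. \<Sum>y\<in>D. \<Sum>z\<in>D. of_bool (z i = y i))"
    by (simp add: M_def fin Int_def)
  also have "\<dots> = (\<Sum>i\<in>{1..n}. \<Sum>y\<in>D. \<Sum>z\<in>D. of_bool (y i = z i))"
    \<comment> \<open>The swap exchanges the roles of \<open>y\<close> and \<open>z\<close>.\<close>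
    by (intro sum.cong refl sum.swap)
  also have "\<dots> = (\<Sum>y\<in>D. \<Sum>i\<in>{1..n}. \<Sum>z\<in>D. of_bool (y i = z i))"
    by (rule sum.swap)
  also have "\<dots> = (\<Sum>y\<in>D. \<Sum>z\<in>D. \<Sum>i\<in>{1..n}. of_bool (y i = z i))"
    by (intro sum.cong refl sum.swap)
  also have "\<dots> = (\<Sum>y\<in>D. \<Sum>z\<in>D. real (card {i \<in> {1..n}. y i = z i}))"
    by (simp add: Int_def)
  also have "\<dots> = d\<^sup>2"
    using design_coincidences[OF assms(1,2)] by (simp add: d_def)
  finally have sq: "(\<Sum>i\<in>{1..n}. \<Sum>j\<in>{1..n}. (M i j)\<^sup>2) = d\<^sup>2" .
  \<comment> \<open>The equality case of Cauchy--Schwarz is obtained by hand: \<open>d / n\<close>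
    is the mean of each row, and the squared deviations from it are shown to sum to zero.\<close>
  have "(\<Sum>i\<in>{1..n}. \<Sum>j\<in>{1..n}. (M i j - d / n)\<^sup>2)
      = (\<Sum>i\<in>{1..n}. (\<Sum>j\<in>{1..n}. (M i j)\<^sup>2) - 2 * (d / n) * (\<Sum>j\<in>{1..n}. M i j) + n * (d / n)\<^sup>2)"
    by (intro sum.cong refl)
      (simp add: power2_diff sum.distrib sum_subtractf sum_distrib_left sum_divide_distrib mult_ac)
  \<comment> \<open>Row sum \<open>d\<close> makes the last two terms
    \<open>- 2 * d\<^sup>2 / n\<close> and \<open>d\<^sup>2 / n\<close>. Over all \<open>n\<close>
    rows what is left of them cancels \<open>sq\<close>.\<close>
  also have "\<dots> = (\<Sum>i\<in>{1..n}. (\<Sum>j\<in>{1..n}. (M i j)\<^sup>2) - d\<^sup>2 / n)"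
    using assms(1) by (intro sum.cong refl) (simp add: row[simplified] power2_eq_square)
  also have "\<dots> = 0"
    using assms(1) by (simp add: sum_subtractf sq[simplified])
  finally have "(\<Sum>j\<in>{1..n}. (M i j - d / n)\<^sup>2) = 0"
    by (rule sum_nonneg_0[rotated 2, OF _ assms(3)]) (auto intro: sum_nonneg)
  then have "(M i j - d / n)\<^sup>2 = 0"
    by (rule sum_nonneg_0[rotated 2, OF _ assms(4)]) auto
  then have "M i j > 0"
    using pos assms(1) by (simp add: d_def)
  then have "{y \<in> D. y i = j} \<noteq> {}"
    by (auto simp only: M_def card.empty)
  then show ?thesis
    by blast
qed

theorem theorem3:
  fixes n :: nat and D :: "(nat \<Rightarrow> nat) set"
  assumes "n \<ge> 1"
    and "D \<subseteq> sym_grp n"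
    and "D \<noteq> {}"
    and "is_design n 1 D"
  shows "covering_radius n D \<le> n - 1"
proof -
  have fin: "finite D"
    using assms(2) finite_sym_grp finite_subset by blast
  have "Min ((\<lambda>y. dS n x y) ` D) \<le> n - 1" if "x \<in> sym_grp n" for x
  proof -
    have one: "1 \<in> {1..n}"
      using assms(1) by simp
    then have "x 1 \<in> {1..n}"
      using permutes_in_image[of x "{1..n}" 1] that by (simp add: sym_grp_def)
    \<comment> \<open>A single agreement, here at the letter \<open>1\<close>, already brings the
      distance from \<open>x\<close> to \<open>y\<close> down to at most
      \<open>n - 1\<close>.\<close>
    then obtain y where y: "y \<in> D" "y 1 = x 1"
      using design_transitive[OF assms(1,4) one] by blast
    then have "1 \<in> {i \<in> {1..n}. x i = y i}"
      using one by simp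
    then have "card {i \<in> {1..n}. x i = y i} > 0"
      unfolding card_gt_0_iff by (intro conjI) (blast, simp)
    moreover have "fixpts n (x \<circ> inv y) = card {i \<in> {1..n}. x i = y i}"
      using y(1) assms(2) by (intro fixpts_comp_inv) blast
    ultimately have "dS n x y \<le> n - 1"
      unfolding dS_def by linarith
    moreover have "Min ((\<lambda>y. dS n x y) ` D) \<le> dS n x y"
      using fin y by simp
    ultimately show ?thesis
      by linarith
  qed
  moreover have "sym_grp n \<noteq> {}"
    using assms by blast
  ultimately show ?thesis
    by (simp add: covering_radius_def finite_sym_grp)
qed

end
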